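(* Let $F$ be a field of good heredity and let $E \supseteq F$ be a finite field extension of $F$. Then $E$ also has good heredity.
   Context: Let $F$ be a field with algebraic closure $F^{alg}$. A polynomial $P \in F[x]$ is hereditarily irreducible over $F$ if for every integer $n\ge 1$ the polynomial $P(x^n)$ is irreducible over $F$. A polynomial $P\in F[x]$ has good heredity (over $F$) if for some integer $n \geq 1$ the polynomial $P(x^n)$ factors (up to a nonzero constant) as a product of polynomials in $F[x]$ that are hereditarily irreducible over $F$. The field $F$ has good heredity if every polynomial $P \in F[x]$, none of whose roots in $F^{alg}$ is zero or a root of unity, has good heredity over $F$. *)

theory Defs
  imports "HOL-Algebra.Algebraic_Closure_Type"
begin

definition poly_subst_power :: "'a::field poly \<Rightarrow> nat \<Rightarrow> 'a poly" where
  "poly_subst_power P n = pcompose P (Polynomial.monom 1 n)"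

(* The name irreducible is qualified because HOL-Algebra has a constant of the same name. *)
definition hereditarily_irreducible :: "'a::field poly \<Rightarrow> bool" where
  "hereditarily_irreducible P \<longleftrightarrow>
     (\<forall>n\<ge>1. Factorial_Ring.irreducible (poly_subst_power P n))"

(* Factors may repeat, hence a multiset; with the empty multiset, nonzero constants
   have good heredity. *)
definition good_heredity :: "'a::field poly \<Rightarrow> bool" where
  "good_heredity P \<longleftrightarrow>
     (\<exists>n\<ge>1. \<exists>c Qs. c \<noteq> 0 \<and> (\<forall>Q\<in>#Qs. hereditarily_irreducible Q) \<and>
        poly_subst_power P n = smult c (prod_mset Qs))"

definition root_of_unity :: "'a::field \<Rightarrow> bool" where
  "root_of_unity z \<longleftrightarrow> (\<exists>n\<ge>1. z ^ n = 1)"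

(* Here to_ac embeds the field into its algebraic closure. The zero polynomial does not
   satisfy the hypothesis on the roots, because 0 is one of its roots. *)
definition good_heredity_field :: "'a::field itself \<Rightarrow> bool" where
  "good_heredity_field F \<longleftrightarrow>
     (\<forall>P :: 'a poly.
        (\<forall>z :: 'a alg_closure. poly (map_poly to_ac P) z = 0 \<longrightarrow> z \<noteq> 0 \<and> \<not> root_of_unity z)
        \<longrightarrow> good_heredity P)"

(* An extension E of F is presented by a ring homomorphism from F to E, which is injective
   since F is a field. It makes E a vector space over F. *)
definition field_extension :: "('f::field \<Rightarrow> 'e::field) \<Rightarrow> bool" where
  "field_extension \<iota> \<longleftrightarrow>
     \<iota> 1 = 1 \<and> (\<forall>x y. \<iota> (x + y) = \<iota> x + \<iota> y) \<and> (\<forall>x y. \<iota> (x * y) = \<iota> x * \<iota> y)"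

definition finite_field_extension :: "('f::field \<Rightarrow> 'e::field) \<Rightarrow> bool" where
  "finite_field_extension \<iota> \<longleftrightarrow>
     field_extension \<iota> \<and> (\<exists>B. finite_dimensional_vector_space (\<lambda>c x. \<iota> c * x) B)"

end

theory Submission
  imports Defs "Jordan_Normal_Form.Char_Poly"
begin

text \<open>
  Write \<open>F\<close> for the smaller field, \<open>E\<close> for the larger one, and call a factorization proper if all
  its factors are nonconstant. The first idea is that good heredity is a boundedness condition: \<open>P\<close>
  has good heredity iff the number of factors in a proper factorization of \<open>P(x\<^sup>n)\<close> is bounded
  independently of \<open>n\<close> (lemma \<open>good_heredity_iff_bounded_splitting\<close>). If the number is bounded,
  the factors of a factorization with the most factors, over all \<open>n\<close>, are hereditarily
  irreducible, since splitting one of them after a further substitution \<open>x \<mapsto> x\<^sup>m\<close> would beat the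
  maximum. Conversely, a factorization of \<open>P(x\<^sup>m)\<close> into \<open>k\<close> hereditarily irreducible polynomials
  gives one of \<open>P(x^(m * n))\<close> into \<open>k\<close> irreducible ones, and \<open>P(x\<^sup>n)\<close> splits no further than
  \<open>P(x^(m * n))\<close> does.

  The second idea is to transport factorizations from \<open>E[x]\<close> to \<open>F[x]\<close> by the norm \<open>N\<close>, the
  determinant of multiplication by a polynomial on \<open>E[x]\<close>, which is a free module of finite rank over
  \<open>F[x]\<close>. The norm is multiplicative, commutes with \<open>x \<mapsto> x\<^sup>n\<close>, and takes nonconstant polynomials
  to nonconstant ones, because \<open>P\<close> divides \<open>N(P)\<close> and \<open>N(P) \<noteq> 0\<close> for \<open>P \<noteq> 0\<close>. So a proper
  factorization of \<open>P(x\<^sup>n)\<close> yields one of \<open>N(P)(x\<^sup>n)\<close> with equally many factors, and a bound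
  for \<open>N(P)\<close> over \<open>F\<close> is a bound for \<open>P\<close> over \<open>E\<close>.

  The hypothesis on \<open>F\<close> applies to \<open>N(P)\<close> only if no root of \<open>N(P)\<close> is zero or a root of unity. Such
  a root is a root of \<open>G = x\<close> or of \<open>G = x\<^sup>n - 1\<close>, and these are polynomials over \<open>F\<close> that are
  coprime to \<open>P\<close> in \<open>E[x]\<close>. If \<open>U P + V G = 1\<close>, then multiplication by \<open>U P\<close> is the identity modulo
  \<open>G\<close>, so \<open>N(U) N(P) = 1\<close> modulo \<open>G\<close>, and \<open>N(P)\<close> has no root in common with \<open>G\<close>
  (lemma \<open>poly_norm_poly_nonzero\<close>).
\<close>

section \<open>Good heredity as bounded splitting\<close>

lemma poly_subst_power_mult: "poly_subst_power (P * Q) n = poly_subst_power P n * poly_subst_power Q n"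
  by (simp add: poly_subst_power_def pcompose_mult)

lemma poly_subst_power_smult:
  "poly_subst_power (Polynomial.smult c P) n = Polynomial.smult c (poly_subst_power P n)"
  by (simp add: poly_subst_power_def pcompose_smult)

lemma poly_subst_power_prod_mset:
  "poly_subst_power (prod_mset Qs) n = prod_mset (image_mset (\<lambda>Q. poly_subst_power Q n) Qs)"
  by (induction Qs) (simp_all add: poly_subst_power_mult, simp add: poly_subst_power_def pcompose_1)

lemma poly_subst_power_1: "poly_subst_power P 1 = P"
  by (simp add: poly_subst_power_def monom_altdef)

lemma poly_subst_power_subst_power:
  "poly_subst_power (poly_subst_power P m) n = poly_subst_power P (m * n)"
proof -
  have "pcompose (Polynomial.monom 1 m) (Polynomial.monom 1 n) = (Polynomial.monom 1 (m * n) :: 'a poly)"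
    by (simp add: monom_altdef pcompose_hom.hom_power power_mult mult.commute[of m n] pcompose_pCons)
  then show ?thesis
    by (simp add: poly_subst_power_def pcompose_assoc[symmetric])
qed

lemma degree_poly_subst_power: "degree (poly_subst_power P n) = degree P * n"
  by (simp add: poly_subst_power_def degree_pcompose degree_monom_eq)

definition splits_into :: "'a::field poly \<Rightarrow> nat \<Rightarrow> bool" where
  "splits_into P k \<longleftrightarrow> (\<exists>c Qs. c \<noteq> 0 \<and> (\<forall>Q\<in>#Qs. degree Q > 0) \<and> size Qs = k \<and>
     P = Polynomial.smult c (prod_mset Qs))"

lemma splits_into_subst_power:
  assumes "splits_into P k" "n \<ge> 1" shows "splits_into (poly_subst_power P n) k"
proof -
  obtain c Qs where c: "c \<noteq> 0" and Qs: "\<forall>Q\<in>#Qs. degree Q > 0" "size Qs = k"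
    and P: "P = Polynomial.smult c (prod_mset Qs)"
    using assms(1) by (auto simp: splits_into_def)
  show ?thesis unfolding splits_into_def
  proof (intro exI conjI)
    show "\<forall>Q\<in>#image_mset (\<lambda>Q. poly_subst_power Q n) Qs. degree Q > 0"
      using Qs assms(2) by (auto simp: degree_poly_subst_power)
  qed (use c Qs P in \<open>auto simp: poly_subst_power_smult poly_subst_power_prod_mset\<close>)
qed

text \<open>
  Irreducible polynomials over a field are prime, so each of the \<open>Rs\<close> divides one of the
  nonconstant factors. Cancelling it there removes at most that one factor.
\<close>

lemma splits_into_irreducibles_le:
  assumes "c \<noteq> 0" and irr: "\<And>R. R \<in># Rs \<Longrightarrow> Factorial_Ring.irreducible R"
    and "splits_into (Polynomial.smult c (prod_mset Rs)) k"
  shows "k \<le> size Rs"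
  using assms
proof (induction Rs arbitrary: c k)
  case empty
  then obtain d Qs where Qs: "d \<noteq> 0" "\<forall>Q\<in>#Qs. degree Q > 0" "size Qs = k"
    "[:c:] = Polynomial.smult d (prod_mset Qs)"
    by (auto simp: splits_into_def)
  show ?case
  proof (cases Qs)
    case (add Q Qs')
    have "degree [:c:] = degree Q + degree (prod_mset Qs')"
    proof -
      have "0 \<notin># Qs" using Qs(2) by force
      then have "Q \<noteq> 0" "prod_mset Qs' \<noteq> 0"
        by (auto simp: add prod_mset_zero_iff)
      then show ?thesis
        unfolding Qs(4) add using Qs(1) by (simp add: degree_mult_eq)
    qed
    then show ?thesis using Qs(2) add by auto
  qed (use Qs in auto)
next
  case (add R Rs)
  then obtain d Qs where Qs: "d \<noteq> 0" "\<forall>Q\<in>#Qs. degree Q > 0" "size Qs = k"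
    "Polynomial.smult c (R * prod_mset Rs) = Polynomial.smult d (prod_mset Qs)"
    by (auto simp: splits_into_def)
  have R: "prime_elem R" "R \<noteq> 0"
    using add.prems(2)[of R] by (auto intro: field_poly_irreducible_imp_prime)
  have "R dvd Polynomial.smult d (prod_mset Qs)"
    unfolding Qs(4)[symmetric] by (simp add: dvd_smult)
  then have "R dvd prod_mset Qs"
    using Qs(1) by (simp add: dvd_smult_iff)
  then obtain Q where Q: "Q \<in># Qs" "R dvd Q"
    by (rule prime_elem_dvd_prod_msetE[OF R(1)])
  obtain T where T: "Q = R * T" using Q(2) by (rule dvdE)
  obtain Qs' where Qs': "Qs = add_mset Q Qs'" using Q(1) by (metis multi_member_split)
  have eq: "Polynomial.smult c (prod_mset Rs) = Polynomial.smult d (T * prod_mset Qs')"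
    using Qs(4) R(2) unfolding Qs' T by (simp add: mult.assoc flip: mult_smult_right)
  \<comment> \<open>A constant cofactor \<open>T\<close> is absorbed into \<open>d\<close>; otherwise \<open>T\<close> takes the place of \<open>Q\<close>.\<close>
  have "splits_into (Polynomial.smult c (prod_mset Rs)) (k - 1)
    \<or> splits_into (Polynomial.smult c (prod_mset Rs)) k"
  proof (cases "degree T = 0")
    case True
    have "T \<noteq> 0" using Qs(2) Q(1) T by auto
    then obtain t where t: "T = [:t:]" "t \<noteq> 0"
      using True degree_eq_zeroE by (metis pCons_0_0)
    have "splits_into (Polynomial.smult c (prod_mset Rs)) (k - 1)"
      unfolding splits_into_def
      by (intro exI[of _ "d * t"] exI[of _ Qs']) (use Qs Qs' t eq in auto)
    then show ?thesis ..
  next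
    case False
    have "splits_into (Polynomial.smult c (prod_mset Rs)) k"
      unfolding splits_into_def
      by (intro exI[of _ d] exI[of _ "add_mset T Qs'"]) (use Qs Qs' False eq in auto)
    then show ?thesis ..
  qed
  then show ?case
    using add.IH[of c "k - 1"] add.IH[of c k] add.prems(1,2) by fastforce
qed

lemma splits_into_self: "P \<noteq> 0 \<Longrightarrow> \<exists>k. splits_into P k"
proof (cases "degree P = 0")
  case True
  assume "P \<noteq> 0"
  then obtain c where "P = [:c:]" "c \<noteq> 0" using True by (metis degree_eq_zeroE pCons_0_0)
  then show ?thesis
    by (intro exI[of _ 0]) (auto simp: splits_into_def intro!: exI[of _ c])
next
  case False
  then show ?thesis
    by (intro exI[of _ 1]) (auto simp: splits_into_def intro!: exI[of _ 1] exI[of _ "{#P#}"])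
qed

text \<open>
  This form of good heredity speaks of all factorizations into nonconstant polynomials, with no
  reference to irreducibility, and so it can be compared along a map that does not preserve
  irreducibility, such as the norm.
\<close>

lemma good_heredity_iff_bounded_splitting:
  assumes "P \<noteq> 0"
  shows "good_heredity P \<longleftrightarrow> (\<exists>B. \<forall>n\<ge>1. \<forall>k. splits_into (poly_subst_power P n) k \<longrightarrow> k \<le> B)"
proof
  assume "good_heredity P"
  then obtain m c Qs where m: "m \<ge> 1" and c: "c \<noteq> 0"
    and Qs: "\<forall>Q\<in>#Qs. hereditarily_irreducible Q"
    and P: "poly_subst_power P m = Polynomial.smult c (prod_mset Qs)"
    by (auto simp: good_heredity_def)
  have "k \<le> size Qs" if n: "n \<ge> 1" and k: "splits_into (poly_subst_power P n) k" for n k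
  proof -
    \<comment> \<open>Both substitutions in either order give \<open>P(x^(m * n))\<close>, which splits into the irreducible
      \<open>Q(x\<^sup>n)\<close> on the one hand and into \<open>k\<close> nonconstant factors on the other.\<close>
    let ?Rs = "image_mset (\<lambda>Q. poly_subst_power Q n) Qs"
    have "poly_subst_power (poly_subst_power P n) m = poly_subst_power (poly_subst_power P m) n"
      by (simp add: poly_subst_power_subst_power mult.commute)
    also have "\<dots> = Polynomial.smult c (prod_mset ?Rs)"
      unfolding P by (simp add: poly_subst_power_smult poly_subst_power_prod_mset)
    finally have "splits_into (Polynomial.smult c (prod_mset ?Rs)) k"
      using splits_into_subst_power[OF k m] by simp
    then have "k \<le> size ?Rs"
      by (rule splits_into_irreducibles_le[OF c, rotated])
         (use Qs n in \<open>auto simp: hereditarily_irreducible_def\<close>)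
    then show ?thesis by simp
  qed
  then show "\<exists>B. \<forall>n\<ge>1. \<forall>k. splits_into (poly_subst_power P n) k \<longrightarrow> k \<le> B" by blast
next
  assume "\<exists>B. \<forall>n\<ge>1. \<forall>k. splits_into (poly_subst_power P n) k \<longrightarrow> k \<le> B"
  then obtain B where B: "\<And>n k. n \<ge> 1 \<Longrightarrow> splits_into (poly_subst_power P n) k \<Longrightarrow> k \<le> B" by blast
  let ?Q = "\<lambda>k. \<exists>n\<ge>1. splits_into (poly_subst_power P n) k"
  obtain k0 where "splits_into P k0" using splits_into_self[OF assms] ..
  then have k0: "?Q k0" by (intro exI[of _ 1]) (simp only: poly_subst_power_1, simp)
  define k where "k = Greatest ?Q"
  have Qk: "?Q k" unfolding k_def by (rule GreatestI_nat[where P = ?Q and b = B, OF k0]) (use B in blast)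
  have max: "j \<le> k" if "?Q j" for j
    unfolding k_def by (rule Greatest_le_nat[where P = ?Q and b = B, OF that]) (use B in blast)
  obtain n c Qs where n: "n \<ge> 1" and c: "c \<noteq> 0" and Qs: "\<forall>Q\<in>#Qs. degree Q > 0" "size Qs = k"
    and P: "poly_subst_power P n = Polynomial.smult c (prod_mset Qs)"
    using Qk by (auto simp: splits_into_def)
  have "hereditarily_irreducible Q" if Q: "Q \<in># Qs" for Q
    unfolding hereditarily_irreducible_def
  proof (intro allI impI)
    fix m :: nat assume m: "m \<ge> 1"
    have deg: "degree (poly_subst_power Q m) > 0"
      using m Q Qs by (auto simp: degree_poly_subst_power)
    then have nz: "poly_subst_power Q m \<noteq> 0" by auto
    show "Factorial_Ring.irreducible (poly_subst_power Q m)"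
    proof (rule irreducibleI)
      fix S T assume ST: "poly_subst_power Q m = S * T"
      show "S dvd 1 \<or> T dvd 1"
      proof (rule ccontr)
        assume "\<not> (S dvd 1 \<or> T dvd 1)"
        then have *: "degree S > 0" "degree T > 0"
          using nz ST is_unit_iff_degree[of S] is_unit_iff_degree[of T] by auto
        obtain Qs' where Qs': "Qs = add_mset Q Qs'" using Q by (metis multi_member_split)
        \<comment> \<open>Replacing \<open>Q\<close> by the two factors of \<open>Q(x\<^sup>m)\<close> gives \<open>k + 1\<close> factors of \<open>P(x^(n * m))\<close>.\<close>
        let ?Rs = "add_mset S (add_mset T (image_mset (\<lambda>Q. poly_subst_power Q m) Qs'))"
        have "poly_subst_power P (n * m) = Polynomial.smult c (prod_mset ?Rs)"
          unfolding poly_subst_power_subst_power[symmetric] P Qs'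
          by (simp add: poly_subst_power_smult poly_subst_power_mult ST
              poly_subst_power_prod_mset mult.assoc)
        then have "splits_into (poly_subst_power P (n * m)) (Suc k)"
          unfolding splits_into_def using c Qs Qs' * m
          by (intro exI[of _ c] exI[of _ ?Rs]) (auto simp: degree_poly_subst_power)
        then show False using max[of "Suc k"] n m
          by (metis One_nat_def Suc_n_not_le_n mult_le_mono nat_mult_1)
      qed
    qed (use nz deg is_unit_iff_degree in auto)
  qed
  then show "good_heredity P"
    unfolding good_heredity_def using n c P by blast
qed

section \<open>The norm of a polynomial\<close>

text \<open>
  Substitution moves coefficients without combining them, so it commutes with maps that are only
  additive, such as the coordinate functions of a field extension.
\<close>

lemma map_poly_poly_subst_power:
  assumes "f 0 = 0" "\<And>x y. f (x + y) = f x + f y"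
  shows "map_poly f (poly_subst_power P n) = poly_subst_power (map_poly f P) n"
proof (induction P)
  case (pCons a P)
  have add: "map_poly f (p + q) = map_poly f p + map_poly f q" for p q
    using assms by (intro poly_eqI) (simp add: coeff_map_poly)
  have "map_poly f (Polynomial.monom 1 n * p) = Polynomial.monom 1 n * map_poly f p" for p
    using assms(1) by (intro poly_eqI) (simp add: coeff_map_poly coeff_monom_mult)
  moreover have "map_poly f [:a:] = [:f a:]"
    using assms(1) by (intro poly_eqI) (simp add: coeff_map_poly coeff_pCons split: nat.splits)
  moreover have "map_poly f (pCons a P) = pCons (f a) (map_poly f P)"
    using assms(1) by (intro poly_eqI) (simp add: coeff_map_poly coeff_pCons split: nat.splits)
  ultimately show ?case using pCons
    by (simp add: poly_subst_power_def pcompose_pCons add)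
qed (simp add: poly_subst_power_def)

text \<open>
  A finite extension with a basis \<open>b 0, \<dots>, b (d - 1)\<close> and its dual coordinate functions. The basis
  is numbered so that multiplication by an element becomes a matrix over the smaller field.
\<close>

locale coordinatized_extension =
  fixes \<iota> :: "'f::field \<Rightarrow> 'e::field" and d :: nat and b :: "nat \<Rightarrow> 'e" and coord :: "nat \<Rightarrow> 'e \<Rightarrow> 'f"
  assumes \<iota>_1: "\<iota> 1 = 1" and \<iota>_add: "\<iota> (x + y) = \<iota> x + \<iota> y" and \<iota>_mult: "\<iota> (x * y) = \<iota> x * \<iota> y"
    and expand: "(\<Sum>i<d. \<iota> (coord i e) * b i) = e"
    and coord_add: "coord i (e + e') = coord i e + coord i e'"
    and coord_scale: "coord i (\<iota> x * e) = x * coord i e"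
    and coord_b: "i < d \<Longrightarrow> j < d \<Longrightarrow> coord i (b j) = (if i = j then 1 else 0)"
begin

lemma \<iota>_0: "\<iota> 0 = 0"
  using \<iota>_add[of 0 0] by (metis add.right_neutral add_left_cancel)

sublocale comm_ring_hom \<iota>
  by unfold_locales (simp_all add: \<iota>_0 \<iota>_1 \<iota>_add \<iota>_mult)

sublocale lift: map_poly_comm_ring_hom \<iota> ..

abbreviation lift :: "'f poly \<Rightarrow> 'e poly" where "lift \<equiv> map_poly \<iota>"

definition pcoord :: "nat \<Rightarrow> 'e poly \<Rightarrow> 'f poly" where
  "pcoord i P = map_poly (coord i) P"

text \<open>
  The same basis makes \<open>E[x]\<close> a free module over \<open>F[x]\<close>; \<open>comb\<close> is the isomorphism from
  coordinate vectors, and \<open>pcoord\<close> gives its inverse.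
\<close>

definition comb :: "'f poly vec \<Rightarrow> 'e poly" where
  "comb v = (\<Sum>j<d. Polynomial.smult (b j) (lift (v $ j)))"

definition mult_mat :: "'e poly \<Rightarrow> 'f poly mat" where
  "mult_mat P = mat d d (\<lambda>(i, j). pcoord i (Polynomial.smult (b j) P))"

definition norm_poly :: "'e poly \<Rightarrow> 'f poly" where
  "norm_poly P = Determinant.det (mult_mat P)"

lemma coord_0: "coord i 0 = 0"
  using coord_scale[of i 0 0] by simp

lemma coord_sum: "coord i (sum f A) = (\<Sum>a\<in>A. coord i (f a))"
  by (induction A rule: infinite_finite_induct) (simp_all add: coord_0 coord_add)

lemma coeff_pcoord: "coeff (pcoord i P) k = coord i (coeff P k)"
  by (simp add: pcoord_def coeff_map_poly coord_0)

lemma pcoord_add: "pcoord i (P + Q) = pcoord i P + pcoord i Q"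
  by (intro poly_eqI) (simp add: coeff_pcoord coord_add)

lemma pcoord_0: "pcoord i 0 = 0"
  by (intro poly_eqI) (simp add: coeff_pcoord coord_0)

lemma pcoord_sum: "pcoord i (sum f A) = (\<Sum>a\<in>A. pcoord i (f a))"
  by (induction A rule: infinite_finite_induct) (simp_all add: pcoord_0 pcoord_add)

lemma pcoord_lift_mult: "pcoord i (lift g * P) = g * pcoord i P"
  by (intro poly_eqI) (simp add: coeff_pcoord coeff_mult coord_sum coord_scale)

lemma expand_poly: "(\<Sum>i<d. Polynomial.smult (b i) (lift (pcoord i P))) = P"
proof (intro poly_eqI)
  fix k
  show "coeff (\<Sum>i<d. Polynomial.smult (b i) (lift (pcoord i P))) k = coeff P k"
    using expand[of "coeff P k"] by (simp add: coeff_sum coeff_pcoord mult.commute)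
qed

lemma pcoord_const_b: "i < d \<Longrightarrow> j < d \<Longrightarrow> pcoord i [:b j:] = (if i = j then 1 else 0)"
  by (intro poly_eqI) (simp add: coeff_pcoord coeff_pCons coord_b coord_0 split: nat.splits)

lemma pcoord_comb: "i < d \<Longrightarrow> pcoord i (comb v) = v $ i"
proof -
  assume i: "i < d"
  have "pcoord i (comb v) = (\<Sum>j<d. v $ j * pcoord i [:b j:])"
    by (simp add: comb_def pcoord_sum flip: pcoord_lift_mult)
  also have "\<dots> = (\<Sum>j<d. if j = i then v $ j else 0)"
    by (intro sum.cong) (auto simp: pcoord_const_b i)
  finally show ?thesis using i by simp
qed

lemma mult_mat_carrier [simp]: "mult_mat P \<in> carrier_mat d d"
  by (simp add: mult_mat_def)

lemma mult_mat_index: "i < d \<Longrightarrow> j < d \<Longrightarrow> mult_mat P $$ (i, j) = pcoord i (Polynomial.smult (b j) P)"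
  by (simp add: mult_mat_def)

lemma comb_mult_mat:
  assumes "v \<in> carrier_vec d"
  shows "comb (mult_mat P *\<^sub>v v) = P * comb v"
proof -
  have "P * comb v = (\<Sum>j<d. lift (v $ j) * Polynomial.smult (b j) P)"
    by (simp add: comb_def sum_distrib_left mult.commute[of P])
  also have "pcoord i \<dots> = (mult_mat P *\<^sub>v v) $ i" if "i < d" for i
  proof -
    have "(mult_mat P *\<^sub>v v) $ i = (\<Sum>j<d. v $ j * mult_mat P $$ (i, j))"
      using that assms by (simp add: scalar_prod_def mult_mat_def lessThan_atLeast0 mult.commute)
    then show ?thesis
      using that by (simp add: pcoord_sum pcoord_lift_mult mult_mat_index del: mult_smult_right)
  qed
  then have coords: "pcoord i (P * comb v) = (mult_mat P *\<^sub>v v) $ i" if "i < d" for i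
    using that calculation by simp
  show ?thesis
    unfolding comb_def[of "mult_mat P *\<^sub>v v"]
    using expand_poly[of "P * comb v"] by (simp add: coords)
qed

text \<open>
  Column \<open>j\<close> of \<open>mult_mat Q\<close> lists the coordinates of \<open>b j * Q\<close>, so multiplicativity follows by
  applying \<open>mult_mat P\<close> to each column.
\<close>

lemma mult_mat_mult: "mult_mat (P * Q) = mult_mat P * mult_mat Q"
proof (intro eq_matI)
  fix i j assume "i < dim_row (mult_mat P * mult_mat Q)" "j < dim_col (mult_mat P * mult_mat Q)"
  then have ij: "i < d" "j < d" by (auto simp: mult_mat_def)
  have "Polynomial.smult (b j) Q = comb (Matrix.col (mult_mat Q) j)"
    using ij by (subst expand_poly[symmetric]) (auto simp: comb_def mult_mat_def)
  then have "Polynomial.smult (b j) (P * Q) = comb (mult_mat P *\<^sub>v Matrix.col (mult_mat Q) j)"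
    using ij by (subst comb_mult_mat) (auto simp flip: mult_smult_right simp: mult_mat_def)
  then show "mult_mat (P * Q) $$ (i, j) = (mult_mat P * mult_mat Q) $$ (i, j)"
    using ij by (simp add: mult_mat_index pcoord_comb) (simp add: mult_mat_def)
qed (simp_all add: mult_mat_def)

lemma mult_mat_1: "mult_mat 1 = 1\<^sub>m d"
  by (intro eq_matI) (auto simp: mult_mat_index pcoord_const_b, simp_all add: mult_mat_def)

lemma norm_poly_mult: "norm_poly (P * Q) = norm_poly P * norm_poly Q"
  by (simp add: norm_poly_def mult_mat_mult det_mult[of _ d])

lemma norm_poly_1: "norm_poly 1 = 1"
  by (simp add: norm_poly_def mult_mat_1)

lemma norm_poly_prod_mset: "norm_poly (prod_mset Qs) = prod_mset (image_mset norm_poly Qs)"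
  by (induction Qs) (simp_all add: norm_poly_1 norm_poly_mult)

lemma norm_poly_subst_power: "norm_poly (poly_subst_power P n) = poly_subst_power (norm_poly P) n"
proof -
  interpret subst: comm_ring_hom "\<lambda>p :: 'f poly. poly_subst_power p n"
    by unfold_locales
       (simp_all add: poly_subst_power_def pcompose_add pcompose_mult pcompose_1)
  have "mult_mat (poly_subst_power P n) = map_mat (\<lambda>p. poly_subst_power p n) (mult_mat P)"
    by (intro eq_matI)
       (auto simp: mult_mat_def pcoord_def map_poly_poly_subst_power coord_0 coord_add
         simp flip: poly_subst_power_smult)
  then show ?thesis
    by (simp add: norm_poly_def)
qed

text \<open>
  Applying the adjugate of the matrix of \<open>P\<close> to the coordinates of \<open>1\<close> gives the coordinates of the
  cofactor.
\<close>

lemma dvd_lift_norm_poly: "P dvd lift (norm_poly P)"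
proof -
  let ?M = "mult_mat P" and ?u = "Matrix.vec d (\<lambda>i. pcoord i 1)"
  have adj: "adj_mat ?M \<in> carrier_mat d d" "?M * adj_mat ?M = norm_poly P \<cdot>\<^sub>m 1\<^sub>m d"
    using adj_mat[OF mult_mat_carrier] by (auto simp: norm_poly_def)
  have u: "comb ?u = 1" using expand_poly[of 1] by (simp add: comb_def)
  have "P * comb (adj_mat ?M *\<^sub>v ?u) = comb (?M *\<^sub>v (adj_mat ?M *\<^sub>v ?u))"
    using adj(1) by (intro comb_mult_mat[symmetric]) auto
  also have "?M *\<^sub>v (adj_mat ?M *\<^sub>v ?u) = (?M * adj_mat ?M) *\<^sub>v ?u"
    using adj(1) by (intro assoc_mult_mat_vec[of _ d d _ d, symmetric]) auto
  also have "\<dots> = norm_poly P \<cdot>\<^sub>v ?u"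
    unfolding adj(2) by (intro eq_vecI) (auto simp: smult_scalar_prod_distrib)
  also have "comb \<dots> = lift (norm_poly P) * comb ?u"
    by (simp add: comb_def sum_distrib_left lift.hom_mult)
  finally show ?thesis using u by (metis dvd_triv_left mult.right_neutral)
qed

text \<open>
  A vanishing determinant would give a nonzero kernel vector over the domain \<open>F[x]\<close>, which is a nonzero
  polynomial over \<open>E\<close> annihilated by \<open>P\<close>.
\<close>

lemma norm_poly_nonzero:
  assumes "P \<noteq> 0" shows "norm_poly P \<noteq> 0"
proof
  assume "norm_poly P = 0"
  then obtain v where v: "v \<in> carrier_vec d" "v \<noteq> 0\<^sub>v d" "mult_mat P *\<^sub>v v = 0\<^sub>v d"
    using det_0_iff_vec_prod_zero[OF mult_mat_carrier] by (auto simp: norm_poly_def)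
  have "P * comb v = comb (0\<^sub>v d)" using comb_mult_mat[OF v(1), of P] v(3) by simp
  also have "\<dots> = 0" by (simp add: comb_def)
  finally have "comb v = 0" using assms by simp
  then have "v $ i = 0" if "i < d" for i using pcoord_comb[OF that, of v] by (simp add: pcoord_0)
  then have "v = 0\<^sub>v d" using v(1) by (intro eq_vecI) auto
  then show False using v(2) by simp
qed

lemma degree_norm_poly_pos:
  assumes "degree P > 0" shows "degree (norm_poly P) > 0"
proof (rule ccontr)
  assume "\<not> degree (norm_poly P) > 0"
  moreover have "norm_poly P \<noteq> 0" using assms by (intro norm_poly_nonzero) auto
  ultimately have "norm_poly P dvd 1" by (simp add: is_unit_iff_degree)
  then obtain Q where "1 = norm_poly P * Q" by (rule dvdE)
  then have "lift (norm_poly P) * lift Q = 1" by (metis lift.hom_mult lift.hom_one)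
  then have "P dvd 1" using dvd_lift_norm_poly[of P] by (metis dvd_mult2)
  then show False using assms by (simp add: is_unit_iff_degree)
qed

lemma splits_into_norm_poly:
  assumes "splits_into P k" shows "splits_into (norm_poly P) k"
proof -
  obtain c Qs where c: "c \<noteq> 0" and Qs: "\<forall>Q\<in>#Qs. degree Q > 0" "size Qs = k"
    and P: "P = Polynomial.smult c (prod_mset Qs)"
    using assms by (auto simp: splits_into_def)
  have "norm_poly [:c:] * norm_poly [:inverse c:] = 1"
    using c by (simp add: norm_poly_1 one_pCons[symmetric] flip: norm_poly_mult)
  then have "norm_poly [:c:] dvd 1" by (metis dvd_triv_left)
  then obtain a where a: "norm_poly [:c:] = [:a:]" "a \<noteq> 0"
    by (elim is_unit_polyE) force
  have "norm_poly P = norm_poly [:c:] * norm_poly (prod_mset Qs)"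
    unfolding P by (simp flip: norm_poly_mult)
  then show ?thesis
    unfolding splits_into_def using a Qs
    by (intro exI[of _ a] exI[of _ "image_mset norm_poly Qs"])
       (auto simp: norm_poly_prod_mset degree_norm_poly_pos)
qed

text \<open>
  Evaluation at \<open>z\<close> kills \<open>G\<close>, and multiplication by \<open>lift G\<close> acts on coordinates as multiplication by
  \<open>G\<close>, so evaluation turns the matrix of \<open>U * P = 1 - V * lift G\<close> into the identity matrix. The
  argument stays over the algebraic closure of \<open>F\<close>, so it avoids relating the two closures.
\<close>

lemma poly_norm_poly_nonzero:
  fixes z :: "'f alg_closure"
  assumes coprime: "U * P + V * lift G = 1" and z: "poly (map_poly to_ac G) z = 0"
  shows "poly (map_poly to_ac (norm_poly P)) z \<noteq> 0"
proof -
  interpret ac: comm_ring_hom "to_ac :: 'f \<Rightarrow> 'f alg_closure" by unfold_locales simp_all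
  interpret acp: map_poly_comm_ring_hom "to_ac :: 'f \<Rightarrow> 'f alg_closure" ..
  let ?ev = "\<lambda>p. poly (map_poly to_ac p) z"
  interpret ev: comm_ring_hom ?ev
    by unfold_locales (simp_all add: acp.hom_add acp.hom_mult)
  have UP: "U * P = 1 + lift (- G) * V" using coprime by (simp add: algebra_simps lift.hom_uminus)
  have "map_mat ?ev (mult_mat (U * P)) = 1\<^sub>m d"
  proof (intro eq_matI)
    fix i j assume ij: "i < dim_row (1\<^sub>m d :: 'f alg_closure mat)" "j < dim_col (1\<^sub>m d :: 'f alg_closure mat)"
    have "Polynomial.smult (b j) (U * P) = [:b j:] + lift (- G) * Polynomial.smult (b j) V"
      unfolding UP by (simp add: smult_add_right)
    then have "pcoord i (Polynomial.smult (b j) (U * P)) = pcoord i [:b j:] - G * pcoord i (Polynomial.smult (b j) V)"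
      by (simp only: pcoord_add pcoord_lift_mult) simp
    then show "map_mat ?ev (mult_mat (U * P)) $$ (i, j) = 1\<^sub>m d $$ (i, j)"
      using ij z by (simp add: mult_mat_def ev.hom_minus ev.hom_mult pcoord_const_b)
  qed (simp_all add: mult_mat_def)
  then have "?ev (norm_poly (U * P)) = 1"
    unfolding norm_poly_def by (metis ev.hom_det det_one)
  then show ?thesis by (auto simp: norm_poly_mult ev.hom_mult)
qed

end

section \<open>Coprimality and roots in the algebraic closure\<close>

text \<open>
  A nonzero element of least degree in the ideal generated by \<open>P\<close> and \<open>Q\<close> divides every element of
  the ideal, by division with remainder.
\<close>

lemma poly_bezout:
  fixes P Q :: "'a::field poly"
  assumes "P \<noteq> 0"
  obtains U V where "U * P + V * Q dvd P" "U * P + V * Q dvd Q" "U * P + V * Q \<noteq> 0"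
proof -
  define I where "I = {U * P + V * Q | U V. True}"
  have "1 * P + 0 * Q \<in> I" "0 * P + 1 * Q \<in> I" unfolding I_def by blast+
  then have in_I: "P \<in> I" "Q \<in> I" by simp_all
  then have "P \<in> I - {0}" using assms by simp
  then obtain g where g: "g \<in> I - {0}" and min: "\<And>h. h \<in> I - {0} \<Longrightarrow> degree g \<le> degree h"
    using ex_has_least_nat[of "\<lambda>h. h \<in> I - {0}" P degree] by blast
  obtain U V where UV: "g = U * P + V * Q" using g by (auto simp: I_def)
  have "g dvd A" if A: "A \<in> I" for A
  proof (rule ccontr)
    assume "\<not> g dvd A"
    then have r: "A mod g \<noteq> 0" by (simp add: dvd_eq_mod_eq_0)
    obtain S T where ST: "A = S * P + T * Q" using A by (auto simp: I_def)
    have "A mod g = (S - A div g * U) * P + (T - A div g * V) * Q"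
      by (simp add: minus_div_mult_eq_mod[symmetric] UV[symmetric] algebra_simps)
         (simp add: UV ST algebra_simps)
    then have "A mod g \<in> I - {0}" using r unfolding I_def by blast
    then show False using min degree_mod_less[of g A] g r by fastforce
  qed
  then show ?thesis using g UV in_I that by auto
qed

text \<open>
  A nonconstant common divisor would have a root in the algebraic closure.
\<close>

lemma bezout_of_no_common_root:
  fixes P G :: "'a::field poly"
  assumes "P \<noteq> 0"
    and "\<And>z::'a alg_closure. poly (map_poly to_ac P) z = 0 \<Longrightarrow> poly (map_poly to_ac G) z \<noteq> 0"
  shows "\<exists>U V. U * P + V * G = 1"
proof -
  interpret ac: comm_ring_hom "to_ac :: 'a \<Rightarrow> 'a alg_closure" by unfold_locales simp_all
  interpret acp: map_poly_comm_ring_hom "to_ac :: 'a \<Rightarrow> 'a alg_closure" ..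
  obtain U V g where UV: "g = U * P + V * G" and g: "g dvd P" "g dvd G" "g \<noteq> 0"
    using poly_bezout[OF assms(1)] by metis
  have "degree g = 0"
  proof (rule ccontr)
    assume "degree g \<noteq> 0"
    then have "degree (map_poly to_ac g :: 'a alg_closure poly) > 0"
      by (subst degree_map_poly) auto
    then obtain z :: "'a alg_closure" where z: "poly (map_poly to_ac g) z = 0"
      using alg_closed_imp_poly_has_root by blast
    have "poly (map_poly to_ac A) z = 0" if "g dvd A" for A
      using that z by (auto elim!: dvdE simp: acp.hom_mult)
    then show False using assms(2) g by blast
  qed
  then have "g dvd 1" using g(3) by (simp add: is_unit_iff_degree)
  then obtain W where "1 = g * W" by (rule dvdE)
  then have "(W * U) * P + (W * V) * G = 1" by (simp add: UV algebra_simps)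
  then show ?thesis by blast
qed

lemma poly_map_to_ac_monom_minus_1:
  "poly (map_poly to_ac (Polynomial.monom 1 n - 1)) z = z ^ n - 1"
proof -
  have "map_poly to_ac (Polynomial.monom 1 n - 1 :: 'a poly) = Polynomial.monom 1 n - 1"
    by (intro poly_eqI) (simp add: coeff_map_poly coeff_1)
  then show ?thesis by (simp add: poly_monom)
qed

section \<open>Finite extensions of fields of good heredity\<close>

lemma finite_field_extension_coordinatized:
  assumes "finite_field_extension (\<iota> :: 'f::field \<Rightarrow> 'e::field)"
  obtains d b coord where "coordinatized_extension \<iota> d b coord"
proof -
  obtain B where "finite_dimensional_vector_space (\<lambda>c x. \<iota> c * x) B" and hom: "field_extension \<iota>"
    using assms by (auto simp: finite_field_extension_def)
  then interpret V: finite_dimensional_vector_space "\<lambda>c x. \<iota> c * x" B by simp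
  obtain bs where bs: "set bs = B" "distinct bs" using finite_distinct_list[OF V.finite_Basis] by blast
  let ?coord = "\<lambda>i e. V.representation B e (bs ! i)"
  have "coordinatized_extension \<iota> (length bs) (\<lambda>i. bs ! i) ?coord"
  proof
    fix e
    have "(\<Sum>i<length bs. \<iota> (?coord i e) * bs ! i) = (\<Sum>x\<in>B. \<iota> (V.representation B e x) * x)"
      using bs bij_betw_nth[OF bs(2) refl refl]
      by (intro sum.reindex_bij_betw) simp
    also have "\<dots> = e"
      by (intro V.sum_representation_eq) (auto simp: V.independent_Basis V.span_Basis V.finite_Basis)
    finally show "(\<Sum>i<length bs. \<iota> (?coord i e) * bs ! i) = e" .
  next
    fix i j assume "i < length bs" "j < length bs"
    then show "?coord i (bs ! j) = (if i = j then 1 else 0)"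
      using bs by (subst V.representation_basis) (auto simp: V.independent_Basis nth_eq_iff_index_eq)
  qed (use hom in \<open>simp_all add: field_extension_def V.representation_add V.representation_scale
         V.independent_Basis V.span_Basis\<close>)
  then show ?thesis using that by blast
qed

theorem theorem30:
  fixes \<iota> :: "'f::field \<Rightarrow> 'e::field"
  assumes "good_heredity_field TYPE('f)"
    and "finite_field_extension \<iota>"
  shows "good_heredity_field TYPE('e)"
  unfolding good_heredity_field_def
proof (intro allI impI)
  fix P :: "'e poly"
  assume roots: "\<forall>z :: 'e alg_closure. poly (map_poly to_ac P) z = 0 \<longrightarrow> z \<noteq> 0 \<and> \<not> root_of_unity z"
  obtain d b coord where "coordinatized_extension \<iota> d b coord"
    using finite_field_extension_coordinatized[OF assms(2)] .
  then interpret coordinatized_extension \<iota> d b coord .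
  have P: "P \<noteq> 0" using roots by fastforce
  have "z \<noteq> 0 \<and> \<not> root_of_unity z"
    if z: "poly (map_poly to_ac (norm_poly P)) z = 0" for z :: "'f alg_closure"
  proof -
    have no_common_root: "poly (map_poly to_ac G) z \<noteq> 0"
      if "\<And>w :: 'e alg_closure. poly (map_poly to_ac P) w = 0
        \<Longrightarrow> poly (map_poly to_ac (lift G)) w \<noteq> 0" for G
      using bezout_of_no_common_root[OF P that] poly_norm_poly_nonzero z by blast
    have "z \<noteq> 0"
      using no_common_root[of "[:0, 1:]"] roots by (auto simp: map_poly_pCons)
    moreover have "z ^ n \<noteq> 1" if n: "n \<ge> 1" for n
    proof -
      have "lift (Polynomial.monom 1 n - 1) = Polynomial.monom 1 n - 1"
        by (simp add: lift.hom_minus map_poly_monom \<iota>_0 \<iota>_1)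
      then show ?thesis
        using no_common_root[of "Polynomial.monom 1 n - 1"] roots n
        by (auto simp: poly_map_to_ac_monom_minus_1 root_of_unity_def)
    qed
    ultimately show ?thesis by (auto simp: root_of_unity_def)
  qed
  then have "good_heredity (norm_poly P)"
    using assms(1) by (auto simp: good_heredity_field_def)
  then obtain B where B: "\<And>n k. n \<ge> 1 \<Longrightarrow> splits_into (poly_subst_power (norm_poly P) n) k \<Longrightarrow> k \<le> B"
    using good_heredity_iff_bounded_splitting[OF norm_poly_nonzero[OF P]] by blast
  have "k \<le> B" if "n \<ge> 1" "splits_into (poly_subst_power P n) k" for n k
    using B that splits_into_norm_poly by (metis norm_poly_subst_power)
  then show "good_heredity P"
    using good_heredity_iff_bounded_splitting[OF P] by blast
qed

end
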